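(* Let $\lambda>-1/2$, $\lambda\neq1/2$, $z>0$, and let $(\gamma_n)_{n\ge1}$ be the coefficients of the three-term recurrence relation $xP_n(x)=P_{n+1}(x)+\gamma_nP_{n-1}(x)$ satisfied by the monic polynomials orthogonal with respect to the weight $(1-x^2)^{\lambda-1/2}e^{-zx^2}$ on $(-1,1)$, with $\gamma_0=0$. Define $$g_n=\frac n2+\frac\lambda2-\frac14-z\gamma_n,\qquad n\ge0.$$ Then the equation $$\gamma_n\bigl(n+\lambda-z(\gamma_{n+1}+\gamma_n)\bigr)\bigl(n-1+\lambda-z(\gamma_n+\gamma_{n-1})\bigr)=\left(\frac n2-z\gamma_n\right)\left(\frac{n-1}2+\lambda-z\gamma_n\right),\qquad n\ge1,$$ satisfied by the $\gamma_n$ becomes $$\left(\frac n2+\frac\lambda2-\frac14-g_n\right)(g_{n+1}+g_n)(g_n+g_{n-1})=z\,g_n^2-z\left(\frac\lambda2-\frac14\right)^2,\qquad n\ge1.$$ Moreover, since $R_n$ is positive, $g_n+g_{n+1}\ge0$. The equation for $g_n$ is a modified discrete Painlevé II equation. When $\lambda=1/2$ it recovers the corresponding equation obtained by Dominici and Marcellán for truncated Hermite polynomials.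
   Context: The monic orthogonal polynomials satisfy $\deg P_n=n$ and $\int_{-1}^1P_nP_m\,w\,dx=0$ for $n\ne m$, where $w(x)=(1-x^2)^{\lambda-1/2}e^{-zx^2}$; since the weight is even, the recurrence has the stated form for $n\ge0$ with $P_{-1}=0$, $P_0=1$. Here $h_n=\int_{-1}^1P_n^2(y)w(y)\,dy$ and $R_n=\frac{2\lambda-1}{2h_n}\int_{-1}^1\frac{P_n^2(y)}{1-y}w(y)\,dy$, for which $R_n=n+\lambda-z(\gamma_{n+1}+\gamma_n)=g_n+g_{n+1}$.
   Formalization: The positivity of R_n and g_n+g_{n+1}≥0 are stated only for λ>1/2: for λ<1/2 the integral defining R_n diverges, and the inequality fails, e.g. g_0+g_1=λ−zγ_1<0 for −1/2<λ≤0, and for every λ<1/2 once z is large. *)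

theory Defs
  imports "HOL-Analysis.Analysis" "HOL-Computational_Algebra.Polynomial"
begin

definition monic_orthogonal :: "real set \<Rightarrow> (real \<Rightarrow> real) \<Rightarrow> (nat \<Rightarrow> real poly) \<Rightarrow> bool" where
  "monic_orthogonal S w P \<longleftrightarrow>
     (\<forall>n. degree (P n) = n \<and> lead_coeff (P n) = 1) \<and>
     (\<forall>n m. n \<noteq> m \<longrightarrow> (LINT x:S|lborel. poly (P n) x * poly (P m) x * w x) = 0)"

text \<open>The case distinction encodes the convention \<open>P\<^sub>-\<^sub>1 = 0\<close>.\<close>
definition recurrence_coeffs :: "(nat \<Rightarrow> real poly) \<Rightarrow> (nat \<Rightarrow> real) \<Rightarrow> bool" where
  "recurrence_coeffs P c \<longleftrightarrow>
     c 0 = 0 \<and>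
     (\<forall>n. [:0, 1:] * P n = P (Suc n) + smult (c n) (case n of 0 \<Rightarrow> 0 | Suc m \<Rightarrow> P m))"

definition wt :: "real \<Rightarrow> real \<Rightarrow> real \<Rightarrow> real" where
  "wt lam z x = (1 - x\<^sup>2) powr (lam - 1/2) * exp (- z * x\<^sup>2)"

definition h :: "real \<Rightarrow> real \<Rightarrow> (nat \<Rightarrow> real poly) \<Rightarrow> nat \<Rightarrow> real" where
  "h lam z P n = (LINT y:{-1<..<1}|lborel. (poly (P n) y)\<^sup>2 * wt lam z y)"

text \<open>
  The integrand behaves like \<open>(1 - y) powr (lam - 3/2)\<close> at \<open>y = 1\<close>, so the integral in \<open>R\<close>
  converges only for \<open>lam > 1/2\<close>; for \<open>lam < 1/2\<close> the Lebesgue integral takes the junk value 0.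
\<close>
definition R_integrand :: "real \<Rightarrow> real \<Rightarrow> (nat \<Rightarrow> real poly) \<Rightarrow> nat \<Rightarrow> real \<Rightarrow> real" where
  "R_integrand lam z P n y = (poly (P n) y)\<^sup>2 / (1 - y) * wt lam z y"

definition R :: "real \<Rightarrow> real \<Rightarrow> (nat \<Rightarrow> real poly) \<Rightarrow> nat \<Rightarrow> real" where
  "R lam z P n =
     (2 * lam - 1) / (2 * h lam z P n) * (LINT y:{-1<..<1}|lborel. R_integrand lam z P n y)"

definition g_seq :: "real \<Rightarrow> real \<Rightarrow> (nat \<Rightarrow> real) \<Rightarrow> nat \<Rightarrow> real" where
  "g_seq lam z c n = real n / 2 + lam / 2 - 1/4 - z * c n"

text \<open>Both equations below are meant for \<open>n \<ge> 1\<close>, because of the truncated \<open>n - 1\<close>.\<close>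

definition gamma_equation :: "real \<Rightarrow> real \<Rightarrow> (nat \<Rightarrow> real) \<Rightarrow> nat \<Rightarrow> bool" where
  "gamma_equation lam z c n \<longleftrightarrow>
     c n * (real n + lam - z * (c (n + 1) + c n)) * (real n - 1 + lam - z * (c n + c (n - 1)))
     = (real n / 2 - z * c n) * ((real n - 1) / 2 + lam - z * c n)"

definition modified_dPII :: "real \<Rightarrow> real \<Rightarrow> (nat \<Rightarrow> real) \<Rightarrow> nat \<Rightarrow> bool" where
  "modified_dPII lam z g n \<longleftrightarrow>
     (real n / 2 + lam / 2 - 1/4 - g n) * (g (n + 1) + g n) * (g n + g (n - 1))
     = z * (g n)\<^sup>2 - z * (lam / 2 - 1/4)\<^sup>2"

text \<open>
  The truncated Hermite polynomials of Dominici and Marcellan are the monic orthogonal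
  polynomials for \<open>exp (- x\<^sup>2)\<close> on \<open>(-s, s)\<close>. With \<open>g n = n / 2 - b n\<close>, where \<open>b\<close> are their
  recurrence coefficients, their equation has the parameter \<open>s\<^sup>2\<close>.
\<close>
definition truncated_hermite :: "real \<Rightarrow> (nat \<Rightarrow> real poly) \<Rightarrow> bool" where
  "truncated_hermite s Q \<longleftrightarrow> monic_orthogonal {-s<..<s} (\<lambda>x. exp (- x\<^sup>2)) Q"

definition dominici_marcellan :: "real \<Rightarrow> (nat \<Rightarrow> real) \<Rightarrow> nat \<Rightarrow> bool" where
  "dominici_marcellan s g n \<longleftrightarrow>
     (real n / 2 - g n) * (g (n + 1) + g n) * (g n + g (n - 1)) = s\<^sup>2 * (g n)\<^sup>2"

end

theory Submission
  imports Defs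
begin

text \<open>
  Let \<open>L p = \<integral> p w\<close>. Integrating \<open>((1 - x\<^sup>2) P\<^sub>n P\<^sub>n\<^sub>-\<^sub>1 w)'\<close> over \<open>(-1, 1)\<close> and comparing
  coefficients gives the Freud equation
  \<open>\<gamma>\<^sub>n (2n + 2\<lambda> + 2z - 2z (\<gamma>\<^sub>n\<^sub>+\<^sub>1 + \<gamma>\<^sub>n + \<gamma>\<^sub>n\<^sub>-\<^sub>1)) = n - 2 (\<gamma>\<^sub>0 + \<dots> + \<gamma>\<^sub>n\<^sub>-\<^sub>1)\<close>.
  The difference \<open>E\<^sub>n\<close> of the two sides of the equation for \<open>\<gamma>\<close> satisfies
  \<open>E\<^sub>n\<^sub>+\<^sub>1 - E\<^sub>n = A\<^sub>n D\<^sub>n\<close>, where \<open>A\<^sub>n = n + \<lambda> - z (\<gamma>\<^sub>n\<^sub>+\<^sub>1 + \<gamma>\<^sub>n)\<close> and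
  \<open>D\<^sub>n = 0\<close> is the difference of two consecutive Freud equations, halved; since \<open>E\<^sub>0 = 0\<close>, all
  \<open>E\<^sub>n\<close> vanish. The formula for \<open>R\<^sub>n\<close> comes from integrating
  \<open>((1 + x) P\<^sub>n\<^sup>2 w)'\<close>, which is the same Pearson identity with \<open>\<lambda> - 1\<close> in place of \<open>\<lambda>\<close>. For
  \<open>\<lambda> = 1/2\<close>, uniqueness of the monic orthogonal polynomials identifies them with rescaled truncated
  Hermite polynomials.
\<close>

section \<open>Monic orthogonal polynomials for an abstract linear functional\<close>

lemma coeff_weighted_deriv:
  fixes p :: "real poly"
  shows "coeff ((1 - [:0, 1:]\<^sup>2) * pderiv p) 0 = coeff p 1"
    and "coeff ((1 - [:0, 1:]\<^sup>2) * pderiv p) (Suc k)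
      = (real k + 2) * coeff p (Suc (Suc k)) - real k * coeff p k"
proof -
  have eq: "(1 - [:0, 1:]\<^sup>2) * pderiv p = pderiv p - pCons 0 (pCons 0 (pderiv p))"
    by (simp add: power2_eq_square left_diff_distrib)
  show "coeff ((1 - [:0, 1:]\<^sup>2) * pderiv p) 0 = coeff p 1"
    unfolding eq by (simp add: coeff_pderiv)
  show "coeff ((1 - [:0, 1:]\<^sup>2) * pderiv p) (Suc k)
      = (real k + 2) * coeff p (Suc (Suc k)) - real k * coeff p k"
    unfolding eq by (cases k) (simp_all add: coeff_pderiv algebra_simps)
qed

text \<open>Keeping \<open>L\<close> abstract separates the algebra from the integrals: of the
  weight, only linearity and positivity on squares survive.\<close>

locale monic_orthogonal_polynomials =
  fixes L :: "real poly \<Rightarrow> real" and P :: "nat \<Rightarrow> real poly"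
  assumes L_add: "L (p + q) = L p + L q"
    and L_smult: "L (smult a p) = a * L p"
    and L_pos: "p \<noteq> 0 \<Longrightarrow> L (p * p) > 0"
    and degree_P: "degree (P n) = n"
    and lead_P: "lead_coeff (P n) = 1"
    and L_orth: "n \<noteq> m \<Longrightarrow> L (P n * P m) = 0"
begin

definition sqnorm :: "nat \<Rightarrow> real" where "sqnorm n = L (P n * P n)"

lemma L_zero [simp]: "L 0 = 0"
  using L_smult[of 0 0] by simp

lemma L_diff: "L (p - q) = L p - L q"
  using L_add[of p "smult (-1) q"] L_smult[of "-1" q] by simp

lemma coeff_P_self [simp]: "coeff (P n) n = 1"
  using lead_P[of n] by (simp add: degree_P)

lemma coeff_P_above: "k > n \<Longrightarrow> coeff (P n) k = 0"
  by (simp add: coeff_eq_0 degree_P)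

lemma P_nonzero: "P n \<noteq> 0"
  using coeff_P_self[of n] by force

lemma sqnorm_pos: "sqnorm n > 0"
  by (simp add: sqnorm_def L_pos P_nonzero)

text \<open>Induction on the degree bound: subtracting the multiple of \<open>P n\<close> that
  cancels the top coefficient of \<open>q\<close> lowers the bound, and that multiple is itself
  orthogonal to \<open>P m\<close>.\<close>

lemma L_lower_degree:
  assumes "\<And>k. k \<ge> n \<Longrightarrow> coeff q k = 0" and "n \<le> m"
  shows "L (P m * q) = 0"
  using assms
proof (induction n arbitrary: q)
  case 0
  then have "q = 0" by (simp add: poly_eq_iff)
  then show ?case by simp
next
  case (Suc n)
  let ?r = "q - smult (coeff q n) (P n)"
  have "coeff ?r k = 0" if "k \<ge> n" for k
    using Suc.prems(1)[of k] that by (cases "k = n") (auto simp: coeff_P_above)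
  moreover have "n \<le> m"
    using Suc.prems(2) by simp
  ultimately have "L (P m * ?r) = 0"
    by (rule Suc.IH)
  moreover have "L (P m * P n) = 0"
    using Suc.prems(2) by (intro L_orth) arith
  moreover have "L (P m * ?r) = L (P m * q) - coeff q n * L (P m * P n)"
    by (simp only: right_diff_distrib L_diff mult_smult_right L_smult)
  ultimately show ?case by simp
qed

text \<open>The remainder of \<open>q\<close> after removing its multiple of \<open>P n\<close> has
  lower degree. This reduces later evaluations of \<open>L\<close> to reading off one
  coefficient.\<close>

lemma L_top_degree:
  assumes "\<And>k. k > n \<Longrightarrow> coeff q k = 0"
  shows "L (P n * q) = coeff q n * sqnorm n"
proof -
  let ?r = "q - smult (coeff q n) (P n)"
  have "coeff ?r k = 0" if "k \<ge> n" for k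
    using assms[of k] that by (cases "k = n") (auto simp: coeff_P_above)
  then have "L (P n * ?r) = 0"
    by (rule L_lower_degree[OF _ order_refl])
  moreover have "L (P n * ?r) = L (P n * q) - coeff q n * sqnorm n"
    by (simp only: right_diff_distrib L_diff mult_smult_right L_smult sqnorm_def)
  ultimately show ?thesis by simp
qed

text \<open>The difference of the two monic polynomials has degree below \<open>n\<close>, so it is
  orthogonal to both and hence to itself; positivity makes it zero.\<close>

lemma unique:
  assumes "monic_orthogonal_polynomials L Q"
  shows "Q n = P n"
proof -
  interpret Q: monic_orthogonal_polynomials L Q by fact
  let ?d = "Q n - P n"
  have d: "coeff ?d k = 0" if "k \<ge> n" for k
    using that coeff_P_above[of n k] Q.coeff_P_above[of n k] by (cases "k = n") auto
  have "L (?d * ?d) = L (Q n * ?d) - L (P n * ?d)"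
    by (simp only: left_diff_distrib L_diff)
  also have "\<dots> = 0"
    using L_lower_degree[OF d order_refl] Q.L_lower_degree[OF d order_refl] by simp
  finally show ?thesis
    using L_pos[of ?d] by auto
qed

end

section \<open>Three-term recurrence and the values of the functional\<close>

locale recurrent_orthogonal_polynomials = monic_orthogonal_polynomials +
  fixes c :: "nat \<Rightarrow> real"
  assumes rec: "recurrence_coeffs P c"
begin

lemma c_0 [simp]: "c 0 = 0"
  using rec by (simp add: recurrence_coeffs_def)

lemma rec_0: "pCons 0 (P 0) = P (Suc 0)"
proof -
  have "[:0, 1:] * P 0 = P (Suc 0) + smult (c 0) (case 0 of 0 \<Rightarrow> 0 | Suc m \<Rightarrow> P m)"
    using rec unfolding recurrence_coeffs_def by blast
  then show ?thesis by simp
qed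

lemma rec_Suc: "pCons 0 (P (Suc n)) = P (Suc (Suc n)) + smult (c (Suc n)) (P n)"
proof -
  have "[:0, 1:] * P (Suc n)
      = P (Suc (Suc n)) + smult (c (Suc n)) (case Suc n of 0 \<Rightarrow> 0 | Suc m \<Rightarrow> P m)"
    using rec unfolding recurrence_coeffs_def by blast
  then show ?thesis by simp
qed

text \<open>The trace of parity that is needed: the recurrence has no term in \<open>P n\<close> on
  its right-hand side, so the coefficient is inherited from the previous index.\<close>

lemma coeff_P_subleading: "coeff (P (Suc n)) n = 0"
proof (induction n)
  case 0
  show ?case by (simp flip: rec_0)
next
  case (Suc n)
  show ?case
    using arg_cong[OF rec_Suc[of n], of "\<lambda>p. coeff p (Suc n)"] Suc
    by (simp add: coeff_P_above)
qed

text \<open>Each step of the recurrence lowers this coefficient by one further \<open>c j\<close>.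
  It is the source of the sum in the Freud equation.\<close>

lemma coeff_P_second: "coeff (P (Suc (Suc n))) n = - (\<Sum>j<Suc (Suc n). c j)"
proof (induction n)
  case 0
  show ?case
    using arg_cong[OF rec_Suc[of 0], of "\<lambda>p. coeff p 0"] by simp
next
  case (Suc n)
  show ?case
    using arg_cong[OF rec_Suc[of "Suc n"], of "\<lambda>p. coeff p (Suc n)"] Suc
    by simp
qed

lemma L_shift_next: "L (P (Suc n) * pCons 0 (P n)) = sqnorm (Suc n)"
proof -
  have "coeff (pCons 0 (P n)) k = 0" if "k > Suc n" for k
    using that by (cases k) (auto simp: coeff_P_above)
  from L_top_degree[of "Suc n", OF this] show ?thesis by simp
qed

text \<open>Two evaluations of the same value of \<open>L\<close>: x is attached to
  \<open>P n\<close> in one and to \<open>P (Suc n)\<close> in the other.\<close>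

lemma sqnorm_Suc: "sqnorm (Suc n) = c (Suc n) * sqnorm n"
proof -
  have "sqnorm (Suc n) = L (P n * pCons 0 (P (Suc n)))"
    using L_shift_next[of n] by (simp add: mult.commute)
  also have "\<dots> = c (Suc n) * sqnorm n"
    by (simp add: rec_Suc distrib_left L_add L_smult L_orth sqnorm_def)
  finally show ?thesis .
qed

lemma L_shift_self: "L (P n * pCons 0 (P n)) = 0"
proof (cases n)
  case 0
  then show ?thesis unfolding rec_0 by (simp add: rec_0 L_orth)
next
  case (Suc m)
  show ?thesis
    unfolding Suc rec_Suc by (simp only: distrib_left L_add mult_smult_right L_smult) (simp add: L_orth)
qed

lemma L_shift_shift: "L (pCons 0 (P n) * pCons 0 (P n)) = (c (Suc n) + c n) * sqnorm n"
proof (cases n)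
  case 0
  then show ?thesis
    using sqnorm_Suc[of 0] unfolding rec_0 by (simp add: rec_0 sqnorm_def)
next
  case (Suc m)
  have "L (pCons 0 (P n) * pCons 0 (P n)) = sqnorm (Suc n) + (c n)\<^sup>2 * sqnorm m"
    unfolding Suc rec_Suc
    by (simp add: distrib_left distrib_right L_add L_smult L_orth sqnorm_def power2_eq_square)
  then show ?thesis
    using sqnorm_Suc[of n] sqnorm_Suc[of m] Suc by (simp add: power2_eq_square algebra_simps)
qed

lemma pCons_0_add: "pCons 0 (p + smult a q) = pCons 0 p + smult a (pCons 0 q)"
  by simp

lemma L_deriv: "L (P n * pderiv (P n)) = 0"
  by (rule L_lower_degree[OF _ order_refl]) (simp add: coeff_pderiv coeff_P_above)

lemma L_shift_deriv: "L (P n * pCons 0 (pderiv (P n))) = real n * sqnorm n"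
proof -
  have "coeff (pCons 0 (pderiv (P n))) k = real k * coeff (P n) k" for k
    by (cases k) (simp_all add: coeff_pderiv)
  then show ?thesis
    using L_top_degree[of n "pCons 0 (pderiv (P n))"] by (simp add: coeff_P_above)
qed

text \<open>Of the three factors x, two go to \<open>P (Suc m)\<close> and one to
  \<open>P m\<close>; two uses of the recurrence then leave only known products.\<close>

lemma L_cube_next:
  "L (pCons 0 (pCons 0 (pCons 0 (P (Suc m) * P m))))
     = (c (Suc (Suc m)) + c (Suc m) + c m) * sqnorm (Suc m)"
proof -
  let ?x = "pCons 0 (P m)"
  have "pCons 0 (pCons 0 (P (Suc m)))
      = P (Suc (Suc (Suc m))) + smult (c (Suc (Suc m))) (P (Suc m)) + smult (c (Suc m)) ?x"
    using rec_Suc[of "Suc m"] unfolding rec_Suc[of m] by (simp add: pCons_0_add)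
  moreover have "pCons 0 (pCons 0 (pCons 0 (P (Suc m) * P m)))
      = pCons 0 (pCons 0 (P (Suc m))) * ?x"
    by simp
  ultimately have "L (pCons 0 (pCons 0 (pCons 0 (P (Suc m) * P m))))
      = L (P (Suc (Suc (Suc m))) * ?x) + c (Suc (Suc m)) * L (P (Suc m) * ?x)
        + c (Suc m) * L (?x * ?x)"
    by (simp only: distrib_right L_add mult_smult_left L_smult)
  moreover have "L (P (Suc (Suc (Suc m))) * ?x) = 0"
  proof (rule L_lower_degree)
    show "coeff ?x k = 0" if "k \<ge> Suc (Suc m)" for k
      using that by (cases k) (auto simp: coeff_P_above)
  qed auto
  ultimately show ?thesis
    by (simp only: L_shift_next L_shift_shift sqnorm_Suc) (simp add: algebra_simps)
qed

lemma L_weighted_deriv_lower: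
  "L (P (Suc m) * ((1 - [:0, 1:]\<^sup>2) * pderiv (P m))) = - real m * sqnorm (Suc m)"
proof -
  let ?q = "(1 - [:0, 1:]\<^sup>2) * pderiv (P m)"
  have "coeff ?q k = 0" if "k > Suc m" for k
    using that by (cases k) (auto simp: coeff_weighted_deriv coeff_P_above)
  moreover have "coeff ?q (Suc m) = - real m"
    by (simp add: coeff_weighted_deriv coeff_P_above)
  ultimately show ?thesis
    using L_top_degree[of "Suc m" ?q] by simp
qed

text \<open>Here (1 - x^2) P' has degree \<open>m + 2\<close>, too high for
  \<open>L_top_degree\<close>. Adding a multiple of \<open>P (Suc (Suc m))\<close>, which is
  orthogonal to \<open>P m\<close>, brings the degree down to \<open>m\<close>.\<close>

lemma L_weighted_deriv_upper:
  "L (P m * ((1 - [:0, 1:]\<^sup>2) * pderiv (P (Suc m))))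
     = (real (Suc m) - 2 * (\<Sum>j<Suc m. c j) - real (Suc m) * c (Suc m)) * sqnorm m"
proof -
  let ?n = "Suc m"
  define d where "d = (1 - [:0, 1:]\<^sup>2) * pderiv (P ?n)"
  let ?q = "d + smult (real ?n) (P (Suc ?n))"
  have d_Suc: "coeff d (Suc l) = (real l + 2) * coeff (P ?n) (Suc (Suc l)) - real l * coeff (P ?n) l" for l
    unfolding d_def by (rule coeff_weighted_deriv)
  have "coeff ?q (Suc l) = 0" if "l \<ge> m" for l
  proof -
    \<comment> \<open>In degree \<open>m + 1\<close> all contributions vanish by parity, in degree
      \<open>m + 2\<close> the leading terms cancel, and beyond that both summands are zero.\<close>
    have "l = m \<or> l = Suc m \<or> l > Suc m"
      using that by arith
    then show ?thesis
      by (elim disjE) (simp_all add: d_Suc coeff_P_above coeff_P_subleading)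
  qed
  then have "coeff ?q k = 0" if "k > m" for k
    using that by (cases k) auto
  moreover have "coeff ?q m = real ?n - 2 * (\<Sum>j<?n. c j) - real ?n * c ?n"
  proof (cases m)
    case 0
    then show ?thesis
      using coeff_P_second[of 0] by (simp add: d_def coeff_weighted_deriv)
  next
    case (Suc k)
    have "coeff d m = real ?n + real k * (\<Sum>j<?n. c j)"
      unfolding d_def Suc coeff_weighted_deriv coeff_P_second by (simp add: algebra_simps)
    moreover have "coeff ?q m = coeff d m - real ?n * (\<Sum>j<Suc ?n. c j)"
      unfolding coeff_add coeff_smult coeff_P_second by (simp add: algebra_simps)
    ultimately show ?thesis
      by (simp add: Suc algebra_simps)
  qed
  ultimately have "L (P m * ?q) = (real ?n - 2 * (\<Sum>j<?n. c j) - real ?n * c ?n) * sqnorm m"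
    using L_top_degree[of m ?q] by simp
  then show ?thesis
    by (simp add: d_def distrib_left L_add L_smult L_orth)
qed

section \<open>The Freud equation and the equation for gamma\<close>

text \<open>The weak Pearson identity is applied to \<open>P (Suc m) * P m\<close>; every term is a
  multiple of \<open>sqnorm m\<close>, which is positive and cancels.\<close>

lemma freud_equation:
  assumes pearson: "\<And>p. L ((1 - [:0, 1:]\<^sup>2) * pderiv p) =
      (2 * lam + 1 + 2 * z) * L (pCons 0 p) - 2 * z * L (pCons 0 (pCons 0 (pCons 0 p)))"
  shows "c (Suc m) * (2 * real (Suc m) + 2 * lam + 2 * z - 2 * z * (c (Suc (Suc m)) + c (Suc m) + c m))
      = real (Suc m) - 2 * (\<Sum>j<Suc m. c j)"
proof -
  let ?n = "Suc m"
  have "L ((1 - [:0, 1:]\<^sup>2) * pderiv (P ?n * P m))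
      = L (P m * ((1 - [:0, 1:]\<^sup>2) * pderiv (P ?n))) + L (P ?n * ((1 - [:0, 1:]\<^sup>2) * pderiv (P m)))"
    by (simp add: pderiv_mult distrib_left L_add ac_simps)
  moreover have "L (pCons 0 (P ?n * P m)) = sqnorm ?n"
    using L_shift_next[of m] by simp
  ultimately have "sqnorm m * (c ?n * (2 * real ?n + 2 * lam + 2 * z - 2 * z * (c (Suc ?n) + c ?n + c m)))
      = sqnorm m * (real ?n - 2 * (\<Sum>j<?n. c j))"
    using pearson[of "P ?n * P m"] L_cube_next[of m]
    unfolding L_weighted_deriv_lower L_weighted_deriv_upper sqnorm_Suc
    by (simp add: algebra_simps)
  then show ?thesis
    using sqnorm_pos[of m] by simp
qed

lemma gamma_equation_of_pearson:
  assumes pearson: "\<And>p. L ((1 - [:0, 1:]\<^sup>2) * pderiv p) =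
      (2 * lam + 1 + 2 * z) * L (pCons 0 p) - 2 * z * L (pCons 0 (pCons 0 (pCons 0 p)))"
  shows "gamma_equation lam z c n"
proof (induction n)
  case 0
  show ?case by (simp add: gamma_equation_def)
next
  case (Suc n)
  define A where "A k = real k + lam - z * (c (Suc k) + c k)" for k
  \<comment> \<open>This is \<open>A (n - 1)\<close> for positive \<open>n\<close>. At 0 truncated
    subtraction breaks that reading, harmlessly, because \<open>B\<close> only occurs multiplied by
    \<open>c n\<close>.\<close>
  define B where "B = real n - 1 + lam - z * (c n + c (n - 1))"
  define u where "u k = real k / 2 - z * c k" for k
  have freud: "c n * (2 * real n + 2 * lam + 2 * z - 2 * z * (c (Suc n) + c n + c (n - 1)))
      = real n - 2 * (\<Sum>j<n. c j)"
    using freud_equation[OF pearson, of "n - 1"] by (cases n) auto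
  \<comment> \<open>In the difference of the two Freud equations the products
    \<open>c (Suc n) * c n\<close> cancel and the sums leave only \<open>c n\<close>.\<close>
  have "2 * (c (Suc n) * A (Suc n) - c n * B) = 2 * (u (Suc n) - u n)"
    using freud_equation[OF pearson, of n] freud
    unfolding A_def B_def u_def sum.lessThan_Suc of_nat_Suc
    by (simp only: right_diff_distrib times_divide_eq_right) algebra
  then have incr: "c (Suc n) * A (Suc n) - c n * B = u (Suc n) - u n"
    by simp
  have sum_u: "u (Suc n) + u n + lam - 1/2 = A n"
    by (simp add: u_def A_def field_simps)
  have "c n * A n * B = u n * (u n + lam - 1/2)"
    using Suc by (simp add: gamma_equation_def A_def B_def u_def diff_divide_distrib algebra_simps)
  \<comment> \<open>The increment is multiplied by \<open>A n\<close>, which by \<open>sum_u\<close>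
    turns its right-hand side into a difference of values of u (u + lam - 1/2).\<close>
  then have "c (Suc n) * A (Suc n) * A n
      = u n * (u n + lam - 1/2) + (u (Suc n) - u n) * A n"
    unfolding incr[symmetric] by (simp add: algebra_simps)
  also have "\<dots> = u (Suc n) * (u (Suc n) + lam - 1/2)"
    unfolding sum_u[symmetric] by algebra
  finally show ?case
    by (simp add: gamma_equation_def A_def u_def add_divide_distrib algebra_simps)
qed

end

section \<open>Integrals against the weight and Pearson's equation\<close>

text \<open>With t = (1 + x)/2 one has 1 - x^2 = 4 t (1 - t), so this is a Beta integrand up to a
  constant factor.\<close>

lemma integrable_one_minus_square_powr:
  assumes "lam > -1/2"
  shows "set_integrable lborel {-1<..<1} (\<lambda>x::real. (1 - x\<^sup>2) powr (lam - 1/2))"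
proof -
  let ?f = "\<lambda>t::real. t powr (lam + 1/2 - 1) * (1 - t) powr (lam + 1/2 - 1)"
  have "set_integrable lborel {0..1} ?f"
    using assms by (intro integrable_Beta) auto
  then have "integrable lborel (\<lambda>x. indicator {0..1} (1/2 + 1/2 * x) *\<^sub>R ?f (1/2 + 1/2 * x))"
    unfolding set_integrable_def by (rule lborel_integrable_real_affine) simp
  then have "integrable lborel (\<lambda>x. 4 powr (lam - 1/2) *
      (indicator {0..1} (1/2 + 1/2 * x) *\<^sub>R ?f (1/2 + 1/2 * x)))"
    by (rule integrable_mult_right)
  also have "(\<lambda>x. 4 powr (lam - 1/2) * (indicator {0..1} (1/2 + 1/2 * x) *\<^sub>R ?f (1/2 + 1/2 * x)))
      = (\<lambda>x::real. indicator {-1..1} x *\<^sub>R (1 - x\<^sup>2) powr (lam - 1/2))"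
  proof
    fix x :: real
    show "4 powr (lam - 1/2) * (indicator {0..1} (1/2 + 1/2 * x) *\<^sub>R ?f (1/2 + 1/2 * x))
      = indicator {-1..1} x *\<^sub>R (1 - x\<^sup>2) powr (lam - 1/2)"
    proof (cases "x \<in> {-1..1}")
      case True
      have "1 - x\<^sup>2 = 4 * ((1/2 + 1/2 * x) * (1 - (1/2 + 1/2 * x)))"
        by (simp add: power2_eq_square field_simps)
      then have "(1 - x\<^sup>2) powr (lam - 1/2)
          = 4 powr (lam - 1/2) * ((1/2 + 1/2 * x) powr (lam - 1/2) * (1 - (1/2 + 1/2 * x)) powr (lam - 1/2))"
        using True by (simp only: powr_mult)
      then show ?thesis
        using True by simp
    qed (auto simp: indicator_def)
  qed
  finally have "set_integrable lborel {-1..1} (\<lambda>x::real. (1 - x\<^sup>2) powr (lam - 1/2))"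
    by (simp add: set_integrable_def)
  then show ?thesis
    by (rule set_integrable_subset) auto
qed

lemma poly_wt_integrable:
  assumes "lam > -1/2"
  shows "set_integrable lborel {-1<..<1} (\<lambda>x. poly p x * wt lam z x)"
proof -
  have "compact ((\<lambda>x. poly p x * exp (- z * x\<^sup>2)) ` {-1..1})"
    by (intro compact_continuous_image continuous_intros) auto
  then obtain M where M: "\<bar>poly p x * exp (- z * x\<^sup>2)\<bar> \<le> M" if "x \<in> {-1..1}" for x
    by (force dest!: compact_imp_bounded simp: bounded_iff)
  have "set_integrable lborel {-1<..<1} (\<lambda>x::real. M * (1 - x\<^sup>2) powr (lam - 1/2))"
    using integrable_one_minus_square_powr[OF assms] by simp
  then show ?thesis
  proof (rule set_integrable_bound)
    show "set_borel_measurable lborel {-1<..<1} (\<lambda>x. poly p x * wt lam z x)"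
    proof -
      have [measurable]: "poly p \<in> borel_measurable borel"
        by (intro borel_measurable_continuous_onI continuous_intros)
      show ?thesis
        unfolding set_borel_measurable_def wt_def by measurable
    qed
    show "AE x in lborel. x \<in> {-1<..<1} \<longrightarrow>
        norm (poly p x * wt lam z x) \<le> norm (M * (1 - x\<^sup>2) powr (lam - 1/2))"
    proof (intro AE_I2 impI)
      fix x :: real assume x: "x \<in> {-1<..<1}"
      have "norm (poly p x * wt lam z x)
          = \<bar>poly p x * exp (- z * x\<^sup>2)\<bar> * (1 - x\<^sup>2) powr (lam - 1/2)"
        by (simp add: wt_def abs_mult)
      also have "\<dots> \<le> M * (1 - x\<^sup>2) powr (lam - 1/2)"
        using M[of x] x by (intro mult_right_mono) auto
      also have "\<dots> \<le> norm (M * (1 - x\<^sup>2) powr (lam - 1/2))"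
        by simp
      finally show "norm (poly p x * wt lam z x) \<le> norm (M * (1 - x\<^sup>2) powr (lam - 1/2))" .
    qed
  qed
qed

definition moment :: "real \<Rightarrow> real \<Rightarrow> real poly \<Rightarrow> real" where
  "moment lam z p = (LINT x:{-1<..<1}|lborel. poly p x * wt lam z x)"

lemma moment_add:
  "lam > -1/2 \<Longrightarrow> moment lam z (p + q) = moment lam z p + moment lam z q"
  unfolding moment_def poly_add distrib_right
  by (intro set_integral_add poly_wt_integrable)

lemma moment_smult: "moment lam z (smult a p) = a * moment lam z p"
  by (simp add: moment_def mult.assoc)

text \<open>A zero integral would make the integrand vanish almost everywhere, but inside the
  interval it vanishes only at the finitely many roots of \<open>q\<close>. Sign information on the
  interval alone suffices, so (1 + x) P^2 is covered as well as squares.\<close>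

lemma moment_pos:
  assumes "lam > -1/2" and "q \<noteq> 0" and nonneg: "\<And>x. -1 < x \<Longrightarrow> x < 1 \<Longrightarrow> poly q x \<ge> 0"
  shows "moment lam z q > 0"
proof -
  let ?f = "\<lambda>x. indicator {-1<..<1} x *\<^sub>R (poly q x * wt lam z x)"
  have int: "integrable lborel ?f"
    using poly_wt_integrable[OF assms(1)] by (simp add: set_integrable_def)
  have f: "AE x in lborel. 0 \<le> ?f x"
    using nonneg by (auto simp: wt_def indicator_def)
  have "integral\<^sup>L lborel ?f \<noteq> 0"
  proof
    assume "integral\<^sup>L lborel ?f = 0"
    then have "AE x in lborel. ?f x = 0"
      using integral_nonneg_eq_0_iff_AE[OF int f] by simp
    moreover have "AE x in lborel. x \<notin> {x. poly q x = 0}"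
      using assms(2) by (intro AE_not_in finite_imp_null_set_lborel poly_roots_finite)
    ultimately have "AE x in lborel. x \<notin> {-1<..<1::real}"
    proof eventually_elim
      case (elim x)
      have "1 - x\<^sup>2 \<noteq> 0" if "x \<in> {-1<..<1}"
        using that by (simp add: power2_eq_1_iff)
      with elim show ?case by (auto simp: wt_def)
    qed
    then have "{-1<..<1::real} \<in> null_sets lborel"
      by (simp add: AE_iff_null_sets)
    then show False
      by (simp add: null_sets_def)
  qed
  moreover have "integral\<^sup>L lborel ?f \<ge> 0"
    using f by (rule integral_nonneg_AE)
  ultimately show ?thesis
    by (simp add: moment_def set_lebesgue_integral_def)
qed

text \<open>Differentiability is asked only in the interior, since the derivatives arising here may
  be unbounded at the endpoints.\<close>

lemma set_integral_derivative:
  fixes F f :: "real \<Rightarrow> real"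
  assumes "a \<le> b" and "continuous_on {a..b} F"
    and deriv: "\<And>x. x \<in> {a<..<b} \<Longrightarrow> (F has_real_derivative f x) (at x)"
    and "set_integrable lborel {a<..<b} f"
  shows "(LINT x:{a<..<b}|lborel. f x) = F b - F a"
proof -
  have "(f has_integral F b - F a) {a..b}"
    using assms(1,2) deriv
    by (intro fundamental_theorem_of_calculus_interior)
       (auto simp: has_real_derivative_iff_has_vector_derivative)
  then have "integral {a<..<b} f = F b - F a"
    by (simp add: has_integral_Icc_iff_Ioo integral_unique)
  then show ?thesis
    using set_borel_integral_eq_integral(2)[OF assms(4)] by simp
qed

lemma wt_Suc:
  assumes "-1 < x" "x < 1"
  shows "wt (lam + 1) z x = (1 - x\<^sup>2) * wt lam z x"
proof -
  have "x\<^sup>2 < 1"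
    using assms by (simp add: abs_square_less_1)
  moreover have "lam + 1 - 1/2 = 1 + (lam - 1/2)"
    by simp
  ultimately show ?thesis
    unfolding wt_def by (simp only: powr_add) simp
qed

text \<open>Pointwise form of Pearson's equation: by \<open>wt_Suc\<close> the function
  differentiated is (1 - x^2) w.\<close>

lemma wt_Suc_deriv:
  assumes "-1 < x" "x < 1"
  shows "(wt (lam + 1) z has_real_derivative
    (2 * z * x ^ 3 - (2 * lam + 1 + 2 * z) * x) * wt lam z x) (at x)"
proof -
  have x: "0 < 1 - x\<^sup>2"
    using assms by (simp add: abs_square_less_1)
  have "((\<lambda>x. (1 - x\<^sup>2) powr (lam + 1/2)) has_real_derivative
      (lam + 1/2) * (1 - x\<^sup>2) powr (lam + 1/2 - 1) * (- 2 * x)) (at x)"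
    by (rule DERIV_chain2[where f = "\<lambda>u. u powr (lam + 1/2)" and g = "\<lambda>x. 1 - x\<^sup>2",
          OF has_real_derivative_powr[OF x]]) (auto intro!: derivative_eq_intros)
  then have "((\<lambda>x. (1 - x\<^sup>2) powr (lam + 1/2) * exp (- z * x\<^sup>2)) has_real_derivative
      (lam + 1/2) * (1 - x\<^sup>2) powr (lam + 1/2 - 1) * (- 2 * x) * exp (- z * x\<^sup>2)
      + exp (- z * x\<^sup>2) * (- z * (2 * x)) * (1 - x\<^sup>2) powr (lam + 1/2)) (at x)"
    (is "(_ has_real_derivative ?D) _")
    by (rule DERIV_mult) (auto intro!: derivative_eq_intros)
  moreover have "wt (lam + 1) z = (\<lambda>x. (1 - x\<^sup>2) powr (lam + 1/2) * exp (- z * x\<^sup>2))"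
    by (simp add: fun_eq_iff wt_def add.commute)
  moreover have "?D = (2 * z * x ^ 3 - (2 * lam + 1 + 2 * z) * x) * wt lam z x"
  proof -
    have e1: "lam + 1/2 - 1 = lam - 1/2" and e2: "lam + 1/2 = 1 + (lam - 1/2)"
      by simp_all
    have "(1 - x\<^sup>2) powr (lam + 1/2) = (1 - x\<^sup>2) * (1 - x\<^sup>2) powr (lam - 1/2)"
      unfolding e2 powr_add using x by simp
    then show ?thesis
      unfolding wt_def e1 by (simp only:) (simp add: algebra_simps power2_eq_square power3_eq_cube)
  qed
  ultimately show ?thesis
    by (simp only:)
qed

text \<open>
  Pearson's equation in weak form: the boundary terms vanish because
  \<open>(1 - x\<^sup>2) * wt lam z x = wt (lam + 1) z x\<close> has a positive exponent at \<open>x = 1\<close> and \<open>x = -1\<close>.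
\<close>
lemma moment_pearson:
  assumes "lam > -1/2"
  shows "moment lam z ((1 - [:0, 1:]\<^sup>2) * pderiv p) =
    (2 * lam + 1 + 2 * z) * moment lam z (pCons 0 p)
    - 2 * z * moment lam z (pCons 0 (pCons 0 (pCons 0 p)))"
proof -
  \<comment> \<open>Chosen so that \<open>?q\<close> times the weight is the derivative of
    \<open>?F\<close>.\<close>
  let ?q = "(1 - [:0, 1:]\<^sup>2) * pderiv p + smult (- (2 * lam + 1 + 2 * z)) (pCons 0 p)
    + smult (2 * z) (pCons 0 (pCons 0 (pCons 0 p)))"
  let ?F = "\<lambda>x. poly p x * wt (lam + 1) z x"
  have "(LINT x:{-1<..<1}|lborel. poly ?q x * wt lam z x) = ?F 1 - ?F (-1)"
  proof (rule set_integral_derivative)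
    show "continuous_on {-1..1} ?F"
      unfolding wt_def using assms
      by (intro continuous_intros continuous_on_powr') (auto simp: abs_square_le_1)
    show "set_integrable lborel {-1<..<1} (\<lambda>x. poly ?q x * wt lam z x)"
      by (rule poly_wt_integrable[OF assms])
    fix x :: real assume x: "x \<in> {-1<..<1}"
    have "(?F has_real_derivative poly (pderiv p) x * wt (lam + 1) z x
        + (2 * z * x ^ 3 - (2 * lam + 1 + 2 * z) * x) * wt lam z x * poly p x) (at x)"
      using x by (intro DERIV_mult poly_DERIV wt_Suc_deriv) auto
    moreover have "poly (pderiv p) x * wt (lam + 1) z x
        + (2 * z * x ^ 3 - (2 * lam + 1 + 2 * z) * x) * wt lam z x * poly p x
        = poly ?q x * wt lam z x"
    proof -
      have "wt (lam + 1) z x = (1 - x\<^sup>2) * wt lam z x"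
        using x by (simp add: wt_Suc)
      then show ?thesis
        unfolding \<open>wt (lam + 1) z x = _\<close>
        by (simp add: algebra_simps power2_eq_square power3_eq_cube)
    qed
    ultimately show "(?F has_real_derivative poly ?q x * wt lam z x) (at x)"
      by simp
  qed simp
  \<comment> \<open>The base of the power is 0 at both endpoints, and \<open>powr\<close> with base
    0 is 0; the continuity of \<open>?F\<close> shown above makes these values the true
    limits.\<close>
  also have "\<dots> = 0"
    by (simp add: wt_def)
  finally have "moment lam z ?q = 0"
    by (simp only: moment_def)
  then show ?thesis
    by (simp only: moment_add[OF assms] moment_smult)
qed

lemma moment_shift:
  "moment lam z ((1 - [:0, 1:]\<^sup>2) * q) = moment (lam + 1) z q"
  unfolding moment_def
  by (rule set_lebesgue_integral_cong) (auto simp: wt_Suc power2_eq_square mult_ac)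

lemma monic_orthogonal_moment:
  assumes "lam > -1/2" and "monic_orthogonal {-1<..<1} (wt lam z) P"
  shows "monic_orthogonal_polynomials (moment lam z) P"
proof
  show "moment lam z (p + q) = moment lam z p + moment lam z q" for p q
    using assms(1) by (rule moment_add)
  show "moment lam z (smult a p) = a * moment lam z p" for a p
    by (rule moment_smult)
  show "moment lam z (p * p) > 0" if "p \<noteq> 0" for p
    using that by (intro moment_pos[OF assms(1)]) auto
  show "degree (P n) = n" and "lead_coeff (P n) = 1" for n
    using assms(2) unfolding monic_orthogonal_def by blast+
  show "moment lam z (P n * P m) = 0" if "n \<noteq> m" for n m
    using assms(2) that by (auto simp: monic_orthogonal_def moment_def)
qed

lemma recurrent_orthogonal_moment:
  assumes "lam > -1/2" and "monic_orthogonal {-1<..<1} (wt lam z) P" and "recurrence_coeffs P c"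
  shows "recurrent_orthogonal_polynomials (moment lam z) P c"
  using monic_orthogonal_moment[OF assms(1,2)] assms(3)
  by (simp add: recurrent_orthogonal_polynomials_def recurrent_orthogonal_polynomials_axioms_def)

lemma gamma_equation_orthogonal:
  assumes "lam > -1/2" and "monic_orthogonal {-1<..<1} (wt lam z) P" and "recurrence_coeffs P c"
  shows "gamma_equation lam z c n"
proof -
  interpret recurrent_orthogonal_polynomials "moment lam z" P c
    by (rule recurrent_orthogonal_moment) fact+
  show ?thesis
    by (rule gamma_equation_of_pearson) (rule moment_pearson[OF assms(1)])
qed

section \<open>The quantities R_n\<close>

text \<open>Writing 1/(1 - y) as (1 + y)/(1 - y^2) absorbs the pole into the weight, whose parameter
  drops by one.\<close>

lemma R_integrand_eq_poly_wt:
  assumes "-1 < y" "y < 1"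
  shows "R_integrand lam z P n y = poly ([:1, 1:] * (P n * P n)) y * wt (lam - 1) z y"
proof -
  have "wt lam z y = (1 - y\<^sup>2) * wt (lam - 1) z y"
    using wt_Suc[OF assms, of "lam - 1" z] by simp
  also have "1 - y\<^sup>2 = (1 - y) * (1 + y)"
    by (simp add: power2_eq_square algebra_simps)
  finally show ?thesis
    using assms by (simp add: R_integrand_def power2_eq_square) (simp add: algebra_simps)
qed

lemma R_integrand_integrable:
  assumes "lam > 1/2"
  shows "set_integrable lborel {-1<..<1} (R_integrand lam z P n)"
proof -
  have "set_integrable lborel {-1<..<1} (R_integrand lam z P n) \<longleftrightarrow>
      set_integrable lborel {-1<..<1} (\<lambda>y. poly ([:1, 1:] * (P n * P n)) y * wt (lam - 1) z y)"
    by (rule set_integrable_cong) (simp_all add: R_integrand_eq_poly_wt del: mult_pCons_left)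
  then show ?thesis
    using poly_wt_integrable[of "lam - 1" "[:1, 1:] * (P n * P n)" z] assms by simp
qed

lemma integral_R_integrand:
  "(LINT y:{-1<..<1}|lborel. R_integrand lam z P n y) = moment (lam - 1) z ([:1, 1:] * (P n * P n))"
  unfolding moment_def
  by (rule set_lebesgue_integral_cong) (simp_all add: R_integrand_eq_poly_wt del: mult_pCons_left)

lemma h_eq_moment: "h lam z P n = moment lam z (P n * P n)"
  by (simp add: h_def moment_def power2_eq_square)

text \<open>Pearson's identity for \<open>lam - 1\<close> is applied to p = (1 + x) P_n^2, whose
  moment \<open>I\<close> is the integral in R_n.\<close>

lemma
  assumes lam: "lam > 1/2" and "monic_orthogonal {-1<..<1} (wt lam z) P" and "recurrence_coeffs P c"
  shows R_pos: "R lam z P n > 0"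
    and R_eq: "R lam z P n = real n + lam - z * (c (n + 1) + c n)"
proof -
  interpret recurrent_orthogonal_polynomials "moment lam z" P c
    using assms by (intro recurrent_orthogonal_moment) auto
  have lam': "lam - 1 > -1/2"
    using lam by simp
  define q where "q = P n * P n"
  define p where "p = [:1, 1:] * q"
  define H where "H = moment lam z q"
  define I where "I = moment (lam - 1) z p"
  have H_pos: "H > 0"
    using sqnorm_pos[of n] by (simp add: H_def q_def sqnorm_def)
  have "I > 0"
    unfolding I_def
  proof (rule moment_pos[OF lam'])
    show "p \<noteq> 0"
      using P_nonzero[of n] by (simp add: p_def q_def del: mult_pCons_left)
    show "poly p x \<ge> 0" if "-1 < x" for x
    proof -
      have "poly p x = (1 + x) * (poly (P n) x * poly (P n) x)"
        by (simp add: p_def q_def algebra_simps)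
      then show ?thesis using that by simp
    qed
  qed
  have R: "R lam z P n = (2 * lam - 1) / (2 * H) * I"
    by (simp only: R_def h_eq_moment integral_R_integrand p_def q_def H_def I_def)
  show "R lam z P n > 0"
    unfolding R using lam H_pos \<open>I > 0\<close> by simp

  let ?v = "1 - [:0, 1:]\<^sup>2 :: real poly"
  have shift: "moment (lam - 1) z (?v * r) = moment lam z r" for r
    using moment_shift[of "lam - 1" z r] by simp
  have add': "moment (lam - 1) z (r + s) = moment (lam - 1) z r + moment (lam - 1) z s" for r s
    by (rule moment_add[OF lam'])
  \<comment> \<open>Multiples of 1 - x^2 are split off because \<open>shift\<close> turns their
    moments for \<open>lam - 1\<close> into moments for \<open>lam\<close>.\<close>
  have "p = pCons 0 p + ?v * q"
    by (simp add: p_def power2_eq_square algebra_simps)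
  then have m1: "I = moment (lam - 1) z (pCons 0 p) + H"
    unfolding I_def H_def by (metis add' shift)
  have "pCons 0 p = pCons 0 (pCons 0 (pCons 0 p)) + ?v * pCons 0 p"
    by (simp add: power2_eq_square algebra_simps)
  then have m3: "moment (lam - 1) z (pCons 0 p)
      = moment (lam - 1) z (pCons 0 (pCons 0 (pCons 0 p))) + moment lam z (pCons 0 p)"
    by (metis add' shift)
  have "pCons 0 p = P n * pCons 0 (P n) + pCons 0 (P n) * pCons 0 (P n)"
    by (simp add: p_def q_def)
  then have xp: "moment lam z (pCons 0 p) = (c (Suc n) + c n) * H"
    by (simp only: L_add L_shift_self L_shift_shift H_def q_def sqnorm_def)
  have dq: "pderiv q = smult 2 (P n * pderiv (P n))"
    by (rule poly_eqI) (simp only: q_def pderiv_mult coeff_add coeff_smult mult.commute mult_2)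
  have "pderiv p = q + pderiv q + pCons 0 (pderiv q)"
    by (simp add: p_def pderiv_add pderiv_pCons)
  then have "pderiv p = q + smult 2 (P n * pderiv (P n)) + smult 2 (P n * pCons 0 (pderiv (P n)))"
    by (simp add: dq)
  then have dp: "moment lam z (pderiv p) = H + 2 * (real n * H)"
    by (simp only: L_add L_smult L_deriv L_shift_deriv H_def q_def sqnorm_def)
  have "moment lam z (pderiv p) = (2 * (lam - 1) + 1 + 2 * z) * moment (lam - 1) z (pCons 0 p)
    - 2 * z * moment (lam - 1) z (pCons 0 (pCons 0 (pCons 0 p)))"
    using moment_pearson[OF lam', of z p] by (simp only: shift)
  \<comment> \<open>\<open>m1\<close> and \<open>m3\<close> eliminate the moments of x p and x^3 p
    for \<open>lam - 1\<close>; the terms \<open>2 * z * I\<close> cancel.\<close>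
  then have "(2 * lam - 1) * I = 2 * H * (real n + lam - z * (c (n + 1) + c n))"
    unfolding dp using m1 m3 xp unfolding Suc_eq_plus1 by algebra
  then show "R lam z P n = real n + lam - z * (c (n + 1) + c n)"
    unfolding R using H_pos by (simp add: field_simps)
qed

section \<open>Passage to the modified discrete Painleve II equation\<close>

text \<open>The second equation is \<open>z\<close> times the first: its right-hand side is a
  difference of squares whose two factors are those of the gamma equation.\<close>

lemma gamma_equation_iff_modified_dPII:
  assumes "z \<noteq> 0" and "n \<ge> 1"
  shows "gamma_equation lam z c n \<longleftrightarrow> modified_dPII lam z (g_seq lam z c) n"
proof -
  let ?g = "g_seq lam z c"
  have "real (n - 1) = real n - 1"
    using assms(2) by simp
  then have g: "?g (n + 1) + ?g n = real n + lam - z * (c (n + 1) + c n)"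
      "?g n + ?g (n - 1) = real n - 1 + lam - z * (c n + c (n - 1))"
      "real n / 2 + lam / 2 - 1/4 - ?g n = z * c n"
      "(?g n)\<^sup>2 - (lam / 2 - 1/4)\<^sup>2 = (real n / 2 - z * c n) * ((real n - 1) / 2 + lam - z * c n)"
    by (simp_all add: g_seq_def field_simps power2_eq_square)
  have "modified_dPII lam z ?g n \<longleftrightarrow>
      z * (c n * (real n + lam - z * (c (n + 1) + c n)) * (real n - 1 + lam - z * (c n + c (n - 1))))
      = z * ((?g n)\<^sup>2 - (lam / 2 - 1/4)\<^sup>2)"
    unfolding modified_dPII_def g(1-3) right_diff_distrib[of z "(?g n)\<^sup>2"] by (simp only: mult.assoc)
  then show ?thesis
    unfolding g(4) using assms(1) by (simp add: gamma_equation_def)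
qed

lemma modified_dPII_half:
  "z > 0 \<Longrightarrow> modified_dPII (1/2) z u n \<longleftrightarrow> dominici_marcellan (sqrt z) u n"
  by (simp add: modified_dPII_def dominici_marcellan_def)

section \<open>Truncated Hermite polynomials at \<open>lam = 1/2\<close>\<close>

text \<open>The substitution of s x for x carries the weight exp(-x^2) on (-s, s) to exp(-s^2 x^2)
  on (-1, 1); dividing by \<open>s ^ n\<close> restores the leading coefficient 1.\<close>

lemma truncated_hermite_rescale:
  assumes "s > 0" and "truncated_hermite s Q"
  shows "monic_orthogonal_polynomials (moment (1/2) (s\<^sup>2)) (\<lambda>n. smult (1 / s ^ n) (pcompose (Q n) [:0, s:]))"
    (is "monic_orthogonal_polynomials ?L ?p")
proof
  have Q: "degree (Q n) = n" "lead_coeff (Q n) = 1"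
    "n \<noteq> m \<Longrightarrow> (LINT x:{-s<..<s}|lborel. poly (Q n) x * poly (Q m) x * exp (- x\<^sup>2)) = 0" for n m
    using assms(2) unfolding truncated_hermite_def monic_orthogonal_def by blast+
  show "?L (p + q) = ?L p + ?L q" for p q
    by (rule moment_add) simp
  show "?L (smult a p) = a * ?L p" for a p
    by (rule moment_smult)
  show "?L (p * p) > 0" if "p \<noteq> 0" for p
    using that by (intro moment_pos) auto
  show deg: "degree (?p n) = n" for n
    using Q(1) assms(1) by (simp add: degree_pcompose)
  show "lead_coeff (?p n) = 1" for n
    using Q(1,2)[of n] assms(1) lead_coeff_comp[of "[:0, s:]" "Q n"]
    by (simp add: lead_coeff_smult degree_pcompose)
  show "?L (?p n * ?p m) = 0" if "n \<noteq> m" for n m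
  proof -
    let ?f = "\<lambda>x. poly (Q n) x * poly (Q m) x * exp (- x\<^sup>2)"
    have "0 = (LINT x|lborel. indicator {-s<..<s} x *\<^sub>R ?f x)"
      using Q(3)[OF that] by (simp add: set_lebesgue_integral_def)
    also have "\<dots> = \<bar>s\<bar> *\<^sub>R (LINT x|lborel. indicator {-s<..<s} (0 + s * x) *\<^sub>R ?f (0 + s * x))"
      using assms(1) by (intro lborel_integral_real_affine) simp
    also have "(\<lambda>x. indicator {-s<..<s} (0 + s * x) *\<^sub>R ?f (0 + s * x))
        = (\<lambda>x. indicator {-1<..<1} x *\<^sub>R (poly (pcompose (Q n) [:0, s:] * pcompose (Q m) [:0, s:]) x * wt (1/2) (s\<^sup>2) x))"
    proof
      fix x :: real
      have "- s < s * x \<longleftrightarrow> -1 < x" "s * x < s \<longleftrightarrow> x < 1"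
        using assms(1) mult_less_cancel_left_pos[of s "-1" x] by simp_all
      \<comment> \<open>Needed because \<open>0 powr 0\<close> is 0: the factor of \<open>wt\<close>
        with exponent 0 equals 1 only for a nonzero base.\<close>
      moreover have "x\<^sup>2 \<noteq> 1" if "-1 < x" "x < 1"
        using that by (simp add: power2_eq_1_iff)
      ultimately show "indicator {-s<..<s} (0 + s * x) *\<^sub>R ?f (0 + s * x) = indicator {-1<..<1} x *\<^sub>R
          (poly (pcompose (Q n) [:0, s:] * pcompose (Q m) [:0, s:]) x * wt (1/2) (s\<^sup>2) x)"
        by (simp add: indicator_def wt_def poly_pcompose power_mult_distrib mult.commute)
    qed
    finally have "?L (pcompose (Q n) [:0, s:] * pcompose (Q m) [:0, s:]) = 0"
      using assms(1) by (simp add: moment_def set_lebesgue_integral_def)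
    then show ?thesis
      by (simp add: moment_smult)
  qed
qed

text \<open>By uniqueness Q_k(s x) = s^k p_k(x). Substituting s x into the recurrence of
  \<open>Q\<close> and comparing with that of \<open>p\<close> leaves multiples of
  \<open>p m\<close> only, with \<open>n = Suc m\<close>.\<close>

lemma truncated_hermite_coeffs:
  assumes "s > 0" and "truncated_hermite s Q" and Q: "recurrence_coeffs Q b"
    and "monic_orthogonal {-1<..<1} (wt (1/2) (s\<^sup>2)) p" and "recurrence_coeffs p c"
  shows "s\<^sup>2 * c n = b n"
proof (cases n)
  case 0
  then show ?thesis
    using assms(3,5) by (simp add: recurrence_coeffs_def)
next
  case (Suc m)
  interpret recurrent_orthogonal_polynomials "moment (1/2) (s\<^sup>2)" p c
    using assms by (intro recurrent_orthogonal_moment) auto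
  have p: "smult (1 / s ^ k) (pcompose (Q k) [:0, s:]) = p k" for k
    using unique[OF truncated_hermite_rescale[OF assms(1,2)]] by simp
  have Q': "pcompose (Q k) [:0, s:] = smult (s ^ k) (p k)" for k
    unfolding p[of k, symmetric] using assms(1) by simp
  have "[:0, 1:] * Q n = Q (Suc n) + smult (b n) (Q m)"
    using Q unfolding recurrence_coeffs_def Suc by (metis nat.case(2))
  then have "pcompose ([:0, 1:] * Q n) [:0, s:] = pcompose (Q (Suc n) + smult (b n) (Q m)) [:0, s:]"
    by simp
  then have "[:0, s:] * smult (s ^ n) (p n)
      = smult (s ^ Suc n) (p (Suc n)) + smult (b n) (smult (s ^ m) (p m))"
    by (simp only: pcompose_mult pcompose_add pcompose_smult pcompose_pCons Q') simp
  also have "[:0, s:] * smult (s ^ n) (p n) = smult (s ^ Suc n) (pCons 0 (p n))"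
    by (simp add: mult.commute)
  also have "\<dots> = smult (s ^ Suc n) (p (Suc n)) + smult (s ^ Suc n) (smult (c n) (p m))"
    unfolding Suc rec_Suc by (rule smult_add_right)
  finally have "smult (s ^ Suc n * c n) (p m) = smult (b n * s ^ m) (p m)"
    by simp
  then have "s ^ Suc n * c n = b n * s ^ m"
    by (auto dest!: arg_cong[where f = "\<lambda>q. coeff q m"])
  then have "s ^ m * (s\<^sup>2 * c n) = s ^ m * b n"
    by (simp add: Suc power2_eq_square algebra_simps)
  then show ?thesis
    using assms(1) by simp
qed

theorem corollary4p4:
  fixes lam z :: real and P :: "nat \<Rightarrow> real poly" and \<gamma> g :: "nat \<Rightarrow> real"
  assumes "lam > -1/2" and "lam \<noteq> 1/2" and "z > 0"
    and "monic_orthogonal {-1<..<1} (wt lam z) P"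
    and "recurrence_coeffs P \<gamma>"
    and "g = g_seq lam z \<gamma>"
  shows "(\<forall>n\<ge>1. gamma_equation lam z \<gamma> n)
    \<and> (\<forall>c. \<forall>n\<ge>1. gamma_equation lam z c n \<longleftrightarrow> modified_dPII lam z (g_seq lam z c) n)
    \<and> (\<forall>n\<ge>1. modified_dPII lam z g n)
    \<and> (lam > 1/2 \<longrightarrow>
         (\<forall>n. set_integrable lborel {-1<..<1} (R_integrand lam z P n)
            \<and> R lam z P n > 0
            \<and> R lam z P n = real n + lam - z * (\<gamma> (n + 1) + \<gamma> n)
            \<and> R lam z P n = g n + g (n + 1)
            \<and> g n + g (n + 1) \<ge> 0))
    \<and> (\<forall>u. \<forall>n\<ge>1. modified_dPII (1/2) z u n \<longleftrightarrow> dominici_marcellan (sqrt z) u n)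
    \<and> (\<forall>Q b p c. truncated_hermite (sqrt z) Q \<and> recurrence_coeffs Q b
          \<and> monic_orthogonal {-1<..<1} (wt (1/2) z) p \<and> recurrence_coeffs p c
        \<longrightarrow> (\<forall>n. g_seq (1/2) z c n = real n / 2 - b n)
          \<and> (\<forall>n\<ge>1. modified_dPII (1/2) z (g_seq (1/2) z c) n)
          \<and> (\<forall>n\<ge>1. dominici_marcellan (sqrt z) (\<lambda>k. real k / 2 - b k) n))"
proof -
  have half: "(-1/2 :: real) < 1/2"
    by simp
  note z = \<open>z > 0\<close>
  have gam: "gamma_equation lam z \<gamma> n" for n
    by (rule gamma_equation_orthogonal) fact+
  have iff: "gamma_equation l z c n \<longleftrightarrow> modified_dPII l z (g_seq l z c) n" if "n \<ge> 1" for l c n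
    using z that by (intro gamma_equation_iff_modified_dPII) auto
  have sum_g: "real n + lam - z * (\<gamma> (n + 1) + \<gamma> n) = g n + g (n + 1)" for n
    by (simp add: assms(6) g_seq_def field_simps)
  have R: "set_integrable lborel {-1<..<1} (R_integrand lam z P n)
      \<and> R lam z P n > 0
      \<and> R lam z P n = real n + lam - z * (\<gamma> (n + 1) + \<gamma> n)
      \<and> R lam z P n = g n + g (n + 1)
      \<and> g n + g (n + 1) \<ge> 0" if "lam > 1/2" for n
    using R_integrand_integrable[OF that, of z P n] R_pos[OF that assms(4,5), of n]
      R_eq[OF that assms(4,5), of n] sum_g[of n] by simp
  have hermite: "(\<forall>n. g_seq (1/2) z c n = real n / 2 - b n)
      \<and> (\<forall>n\<ge>1. modified_dPII (1/2) z (g_seq (1/2) z c) n)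
      \<and> (\<forall>n\<ge>1. dominici_marcellan (sqrt z) (\<lambda>k. real k / 2 - b k) n)"
    if *: "truncated_hermite (sqrt z) Q" "recurrence_coeffs Q b"
      "monic_orthogonal {-1<..<1} (wt (1/2) z) p" "recurrence_coeffs p c" for Q b p c
  proof -
    have "z * c n = b n" for n
      using truncated_hermite_coeffs[of "sqrt z" Q b p c n] * z by simp
    then have g: "g_seq (1/2) z c = (\<lambda>n. real n / 2 - b n)"
      by (simp add: g_seq_def fun_eq_iff)
    have dPII: "modified_dPII (1/2) z (g_seq (1/2) z c) n" if "n \<ge> 1" for n
      using gamma_equation_orthogonal[OF half *(3,4), of n] iff[OF that] by blast
    then show ?thesis
      using modified_dPII_half[OF z] unfolding g by blast
  qed
  show ?thesis
    using gam iff R hermite modified_dPII_half[OF z] unfolding assms(6) by blast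
qed

end
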